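(* Let $\mathfrak A$ be a finite-dimensional associative algebra with unity over $\mathbb C$ whose Lie index is $1$. Then for generic $F\in\mathfrak A^*$ and all $k\ge 0$, $\dim V_k(\alpha)=0$ for all $\alpha\in\mathbb C\setminus\{0,1\}$, where the spaces $V_k(\alpha)=V_k(\alpha)_F$ are defined in the context.
   Context: The Lie index of $\mathfrak A$ is $\min_{F\in\mathfrak A^*}\dim\{a\in\mathfrak A: F(ab-ba)=0\ \forall b\in\mathfrak A\}$. "For generic $F$" means: for all $F$ in some nonempty Zariski-open subset of the dual space $\mathfrak A^*$. Fix a basis $e_1,\dots,e_n$ of $\mathfrak A$ and for $F\in\mathfrak A^*$ let $A=(F(e_ie_j))_{i,j}$. For a unital algebra of Lie index $1$ the polynomial $\det(\lambda A+\gamma A^T)$ in $\lambda,\gamma$ is non-zero for generic $F$, so one may fix $\mu\in\mathbb C$ such that $A-\mu A^T$ is invertible (the spaces below do not depend on this choice). For $\alpha\in\mathbb C$ define $V_0(\alpha)=\{a\in\mathfrak A: F(ab)=\alpha F(ba)\ \forall b\in\mathfrak A\}$ and recursively, for $k\ge0$, $V_{k+1}(\alpha)=\{b\in\mathfrak A:\exists a\in V_k(\alpha)\ \forall x\in\mathfrak A,\ F(bx)-\alpha F(xb)=F(ax)-\mu F(xa)\}$. *)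

theory Defs
  imports Complex_Main "Jordan_Normal_Form.Matrix"
begin

text \<open>Associativity, distributivity and the unit come from the class \<^class>\<open>ring_1\<close>.  This class
  has $0 \neq 1$, so only the zero algebra is left out, and its Lie index is $0$.\<close>

locale fin_dim_algebra = vector_space scale
  for scale :: "complex \<Rightarrow> 'a::ring_1 \<Rightarrow> 'a" +
  assumes scale_mult_left: "scale c a * b = scale c (a * b)"
    and scale_mult_right: "a * scale c b = scale c (a * b)"
    and finite_dim: "\<exists>B. finite B \<and> span B = UNIV"

definition lie_stabilizer :: "('a::ring_1 \<Rightarrow> complex) \<Rightarrow> 'a set" where
  "lie_stabilizer F = {a. \<forall>b. F (a * b - b * a) = 0}"

text \<open>Polynomial functions on the dual space: the algebra of functions generated by the constants
  and the linear coordinates, which in finite dimension are the evaluations at elements of the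
  algebra.\<close>

inductive poly_fun :: "(('a \<Rightarrow> complex) \<Rightarrow> complex) \<Rightarrow> bool" where
  const: "poly_fun (\<lambda>F. c)"
| eval_at: "poly_fun (\<lambda>F. F a)"
| add: "poly_fun p \<Longrightarrow> poly_fun q \<Longrightarrow> poly_fun (\<lambda>F. p F + q F)"
| mult: "poly_fun p \<Longrightarrow> poly_fun q \<Longrightarrow> poly_fun (\<lambda>F. p F * q F)"

context fin_dim_algebra
begin

definition dual :: "('a \<Rightarrow> complex) set" where
  "dual = {F. Vector_Spaces.linear scale (*) F}"

definition lie_index :: nat where
  "lie_index = (INF F\<in>dual. dim (lie_stabilizer F))"

definition zariski_open :: "('a \<Rightarrow> complex) set \<Rightarrow> bool" where
  "zariski_open U \<longleftrightarrow>
     (\<exists>P. (\<forall>p\<in>P. poly_fun p) \<and> U = dual - {F \<in> dual. \<forall>p\<in>P. p F = 0})"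

definition generically :: "(('a \<Rightarrow> complex) \<Rightarrow> bool) \<Rightarrow> bool" where
  "generically Q \<longleftrightarrow> (\<exists>U. zariski_open U \<and> U \<noteq> {} \<and> (\<forall>F\<in>U. Q F))"

definition is_basis :: "nat \<Rightarrow> (nat \<Rightarrow> 'a) \<Rightarrow> bool" where
  "is_basis n e \<longleftrightarrow>
     inj_on e {..<n} \<and> independent (e ` {..<n}) \<and> span (e ` {..<n}) = UNIV"

end

definition form_mat :: "nat \<Rightarrow> (nat \<Rightarrow> 'a::ring_1) \<Rightarrow> ('a \<Rightarrow> complex) \<Rightarrow> complex mat" where
  "form_mat n e F = mat n n (\<lambda>(i, j). F (e i * e j))"

text \<open>The parameter \<open>\<mu>\<close> is meant to be such that \<open>A - \<mu> A\<^sup>T\<close> is invertible, with \<open>A\<close> the matrix of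
  the form \<open>(a, b) \<mapsto> F (a * b)\<close>.\<close>

primrec V :: "('a::ring_1 \<Rightarrow> complex) \<Rightarrow> complex \<Rightarrow> nat \<Rightarrow> complex \<Rightarrow> 'a set" where
  "V F \<mu> 0 \<alpha> = {a. \<forall>b. F (a * b) = \<alpha> * F (b * a)}"
| "V F \<mu> (Suc k) \<alpha> =
     {b. \<exists>a\<in>V F \<mu> k \<alpha>. \<forall>x. F (b * x) - \<alpha> * F (x * b) = F (a * x) - \<mu> * F (x * a)}"

end

theory Submission
  imports Defs "Jordan_Normal_Form.Determinant"
begin

text \<open>Since \<open>V\<^sub>0(\<alpha>) = 0\<close> forces \<open>V\<^sub>k(\<alpha>) = 0\<close>, only \<open>V\<^sub>0(\<alpha>)\<close> matters.  Let \<open>F\<close> have the scalars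
  as its stabilizer and satisfy \<open>F 1 \<noteq> 0\<close>, and suppose that \<open>0 \<noteq> a \<in> V\<^sub>0(\<alpha>)\<close> with \<open>\<alpha> \<noteq> 0, 1\<close>.  Then \<open>a\<close> is
  not invertible, because \<open>a b = b a = 1\<close> would give \<open>F 1 = \<alpha> F 1\<close>.  As \<open>F (a b x) = \<alpha> F (b x a)\<close>, the
  form \<open>(s, x) \<mapsto> F (s x - x s)\<close> on \<open>a\<AA> \<times> \<AA>\<close> depends on \<open>x\<close> only through \<open>x a\<close>, so it is a pairing
  of \<open>a\<AA>\<close> with \<open>\<AA>a\<close>.  Its left kernel consists of scalars in \<open>a\<AA>\<close>, hence is \<open>0\<close>, while its right
  kernel contains \<open>a\<close> (take \<open>x = 1\<close>).  So \<open>dim a\<AA> < dim \<AA>a\<close>, and by symmetry \<open>dim \<AA>a < dim a\<AA>\<close>, a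
  contradiction.  In particular \<open>A - 2 A\<^sup>T\<close> is invertible, which provides a \<open>\<mu>\<close>.\<close>

section \<open>Determinants as polynomial and continuous functions of their entries\<close>

lemma det_mat_eq_sum_prod:
  "det (mat n n (\<lambda>(i, j). m i j)) =
     (\<Sum>p | p permutes {0..<n}. signof p * (\<Prod>i = 0..<n. m i (p i)))"
  by (subst det_def'[where n = n], simp)
    (intro sum.cong refl arg_cong2[where f = times] prod.cong, auto)

lemma poly_fun_sum:
  assumes "\<And>i. i \<in> I \<Longrightarrow> poly_fun (p i)"
  shows "poly_fun (\<lambda>F. \<Sum>i\<in>I. p i F)"
  using assms
  by (induction I rule: infinite_finite_induct) (auto intro: poly_fun.intros)

lemma poly_fun_prod:
  assumes "\<And>i. i \<in> I \<Longrightarrow> poly_fun (p i)"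
  shows "poly_fun (\<lambda>F. \<Prod>i\<in>I. p i F)"
  using assms
  by (induction I rule: infinite_finite_induct) (auto intro: poly_fun.intros)

lemma poly_fun_det:
  assumes "\<And>i j. i < n \<Longrightarrow> j < n \<Longrightarrow> poly_fun (\<lambda>F. M F i j)"
  shows "poly_fun (\<lambda>F. det (mat n n (\<lambda>(i, j). M F i j)))"
  unfolding det_mat_eq_sum_prod using assms
  by (auto intro!: poly_fun_sum poly_fun_prod poly_fun.mult poly_fun.const)

lemma continuous_det:
  fixes M :: "complex \<Rightarrow> nat \<Rightarrow> nat \<Rightarrow> complex"
  assumes "\<And>i j. i < n \<Longrightarrow> j < n \<Longrightarrow> isCont (\<lambda>t. M t i j) s"
  shows "isCont (\<lambda>t. det (mat n n (\<lambda>(i, j). M t i j))) s"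
  unfolding det_mat_eq_sum_prod using assms by (auto intro!: continuous_intros)

lemma invertible_mat_if_det_nonzero:
  fixes A :: "complex mat"
  assumes "A \<in> carrier_mat n n" and "det A \<noteq> 0"
  shows "invertible_mat A"
proof -
  have "A \<in> Units (ring_mat TYPE(complex) n ())"
    using det_non_zero_imp_unit[OF assms] .
  then obtain B where "B \<in> carrier_mat n n" "B * A = 1\<^sub>m n" "A * B = 1\<^sub>m n"
    by (auto simp: Units_def ring_mat_def)
  then show ?thesis
    using assms(1) by (auto simp: invertible_mat_def inverts_mat_def)
qed

section \<open>Dimension bounds from linear equations and pairings\<close>

context finite_dimensional_vector_space
begin

text \<open>Restricting to the kernel of one functional lowers the dimension by at most one, so
  fewer than \<open>dim S\<close> equations cannot cut \<open>S\<close> down to zero.\<close>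

lemma ex_nonzero_common_zero:
  assumes "finite I" and "\<And>i. i \<in> I \<Longrightarrow> Vector_Spaces.linear scale (*) (f i)"
    and "subspace S" and "card I < dim S"
  shows "\<exists>s\<in>S. s \<noteq> 0 \<and> (\<forall>i\<in>I. f i s = 0)"
  using assms
proof (induction I arbitrary: S rule: finite_induct)
  case empty
  then have "\<not> S \<subseteq> {0}"
    by (metis card.empty dim_eq_0 less_numeral_extra(3))
  then show ?case by auto
next
  case (insert i I)
  interpret f: Vector_Spaces.linear scale "(*)" "f i"
    using insert.prems by auto
  define T where "T = {s \<in> S. f i s = 0}"
  have T: "subspace T"
    using insert.prems(2) unfolding T_def subspace_def
    by (auto simp: f.add f.scale f.zero)
  have "dim S \<le> dim T + 1"
  proof (cases "S = T")
    case False
    then obtain s where s: "s \<in> S" "f i s \<noteq> 0"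
      by (auto simp: T_def)
    have "S \<subseteq> span (insert s T)"
    proof
      fix x assume x: "x \<in> S"
      have "x - scale (f i x / f i s) s \<in> T"
        using x s insert.prems(2) by (auto simp: T_def f.diff f.scale subspace_diff subspace_scale)
      then show "x \<in> span (insert s T)"
        by (auto simp: span_insert intro: span_base)
    qed
    then have "dim S \<le> dim (insert s T)"
      by (metis dim_span dim_subset)
    also have "\<dots> \<le> dim T + 1"
      by (simp add: dim_insert)
    finally show ?thesis .
  qed simp
  then have "card I < dim T"
    using insert by simp
  then show ?case
    using insert.IH[OF _ T] insert.prems(1) by (auto simp: T_def)
qed

text \<open>By \<open>desc\<close>, for \<open>s\<close> in \<open>S\<close> the functional
  \<open>\<beta> s\<close> factors through \<open>R\<close>, so it is determined by its values at
  preimages of a basis of \<open>range R\<close>. If \<open>R u\<close> belongs to that basis, its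
  equation holds on all of \<open>S\<close>. The remaining \<open>dim (range R) - 1\<close>
  equations would have a nonzero common solution if \<open>dim S\<close> were at least
  \<open>dim (range R)\<close>, against \<open>nondeg\<close>.\<close>

lemma dim_less_dim_range_of_pairing:
  assumes R: "Vector_Spaces.linear scale scale R"
    and S: "subspace S"
    and left: "\<And>x. Vector_Spaces.linear scale (*) (\<lambda>s. \<beta> s x)"
    and right: "\<And>s. Vector_Spaces.linear scale (*) (\<beta> s)"
    and desc: "\<And>s x. s \<in> S \<Longrightarrow> R x = 0 \<Longrightarrow> \<beta> s x = 0"
    and nondeg: "\<And>s. s \<in> S \<Longrightarrow> (\<And>x. \<beta> s x = 0) \<Longrightarrow> s = 0"
    and u: "R u \<noteq> 0" "\<And>s. s \<in> S \<Longrightarrow> \<beta> s u = 0"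
  shows "dim S < dim (range R)"
proof (rule ccontr)
  assume *: "\<not> dim S < dim (range R)"
  interpret R: Vector_Spaces.linear scale scale R by fact
  have "independent {R u}"
    using u(1) by simp
  then obtain B where B: "{R u} \<subseteq> B" "B \<subseteq> range R" "independent B" "range R \<subseteq> span B"
    using maximal_independent_subset_extend[of "{R u}" "range R"] by auto
  have finB: "finite B"
    using B(3) by (rule finiteI_independent)
  define r where "r y = inv_into UNIV R y" for y
  have r: "R (r y) = y" if "y \<in> B" for y
    using that B(2) by (auto simp: r_def intro!: f_inv_into_f)
  have "card (B - {R u}) < card B"
    using finB B(1) by (intro psubset_card_mono) auto
  also have "card B = dim (range R)"
    using B by (intro dim_unique[symmetric]) auto
  finally have "card (B - {R u}) < dim S"
    using * by simp
  from ex_nonzero_common_zero[where f = "\<lambda>y s. \<beta> s (r y)", OF _ left S this] finB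
  obtain s where s: "s \<in> S" "s \<noteq> 0" "\<And>y. y \<in> B - {R u} \<Longrightarrow> \<beta> s (r y) = 0"
    by auto
  interpret s: Vector_Spaces.linear scale "(*)" "\<beta> s" by (rule right)
  have eq: "\<beta> s x = \<beta> s x'" if "R x = R x'" for x x'
    using desc[OF s(1), of "x - x'"] that by (simp add: R.diff s.diff)
  have sB: "\<beta> s (r y) = 0" if "y \<in> B" for y
    using s(3)[of y] eq[of "r y" u] r[OF that] u(2)[OF s(1)] that by (cases "y = R u") auto
  \<comment> \<open>The image under \<open>R\<close> of the kernel of \<open>\<beta> s\<close> is a
    subspace containing the basis \<open>B\<close>, hence is all of \<open>range R\<close>; by
    \<open>eq\<close> this makes \<open>\<beta> s\<close> vanish everywhere.\<close>
  have "span B \<subseteq> R ` {x. \<beta> s x = 0}"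
  proof (rule span_minimal)
    show "B \<subseteq> R ` {x. \<beta> s x = 0}"
      using sB r by (metis (mono_tags, lifting) image_eqI mem_Collect_eq subsetI)
    show "subspace (R ` {x. \<beta> s x = 0})"
      by (intro R.subspace_image s.subspace_kernel)
  qed
  then have "\<beta> s x = 0" for x
    using B(4) eq by (metis (mono_tags, lifting) imageE mem_Collect_eq rangeI subset_iff)
  then show False
    using nondeg[OF s(1)] s(2) by blast
qed

end

section \<open>Functionals, one-sided inverses and the twisted stabilizer\<close>

context fin_dim_algebra
begin

lemma finite_dimensional_if_is_basis:
  assumes "is_basis n e"
  shows "finite_dimensional_vector_space scale (e ` {..<n})"
  using assms by unfold_locales (auto simp: is_basis_def)

lemma linear_mult_left: "Vector_Spaces.linear scale scale ((*) a)"
  and linear_mult_right: "Vector_Spaces.linear scale scale (\<lambda>x. x * a)"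
  by (simp_all add: Vector_Spaces.linear_iff vector_space_axioms distrib_left distrib_right
      scale_mult_left scale_mult_right)

lemma dual_add: "F \<in> dual \<Longrightarrow> F (x + y) = F x + F y"
  and dual_diff: "F \<in> dual \<Longrightarrow> F (x - y) = F x - F y"
  and dual_scale: "F \<in> dual \<Longrightarrow> F (scale c x) = c * F x"
  and dual_zero: "F \<in> dual \<Longrightarrow> F 0 = 0"
proof -
  assume "F \<in> dual"
  then interpret F: Vector_Spaces.linear scale "(*)" F by (simp add: dual_def)
  show "F (x + y) = F x + F y" "F (x - y) = F x - F y" "F (scale c x) = c * F x" "F 0 = 0"
    by (simp_all add: F.add F.diff F.scale F.zero)
qed

lemma dualI:
  assumes "\<And>x y. F (x + y) = F x + F y" and "\<And>c x. F (scale c x) = c * F x"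
  shows "F \<in> dual"
proof -
  have "vector_space ((*) :: complex \<Rightarrow> complex \<Rightarrow> complex)"
    by unfold_locales (auto simp: algebra_simps)
  then show ?thesis
    using assms by (simp add: dual_def Vector_Spaces.linear_iff vector_space_axioms)
qed

lemma ex_dual_one: "\<exists>\<psi>\<in>dual. \<psi> 1 = 1"
proof -
  interpret vector_space_pair scale "(*) :: complex \<Rightarrow> complex \<Rightarrow> complex"
    by unfold_locales (auto simp: algebra_simps)
  have "independent {1}" by simp
  from linear_independent_extend[OF this, of "\<lambda>_. 1"] show ?thesis
    by (auto simp: dual_def)
qed

text \<open>Left multiplication by \<open>a\<close> is surjective, hence injective by finite
  dimension, and it sends both \<open>b * a\<close> and \<open>1\<close> to
  \<open>a\<close>.\<close>

lemma right_inverse_imp_left_inverse: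
  fixes a b :: 'a
  assumes "is_basis n e" and "a * b = 1"
  shows "b * a = 1"
proof -
  interpret finite_dimensional_vector_space scale "e ` {..<n}"
    using assms(1) by (rule finite_dimensional_if_is_basis)
  interpret P: finite_dimensional_vector_space_pair scale "e ` {..<n}" scale "e ` {..<n}" ..
  have "surj ((*) a)"
    by (rule surjI[where f = "\<lambda>x. b * x"]) (simp add: assms(2) mult.assoc[symmetric])
  then have "inj ((*) a)"
    by (intro P.linear_surjective_imp_injective linear_mult_left refl)
  moreover have "a * (b * a) = a * 1"
    by (simp add: assms(2) mult.assoc[symmetric])
  ultimately show ?thesis
    by (rule injD)
qed

lemma twisted_stabilizer_trivial:
  assumes basis: "is_basis n e" and F: "F \<in> dual" and F1: "F 1 \<noteq> 0"
    and stab: "lie_stabilizer F \<subseteq> range (\<lambda>c. scale c 1)"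
    and \<alpha>: "\<alpha> \<noteq> 0" "\<alpha> \<noteq> 1"
    and a: "\<And>b. F (a * b) = \<alpha> * F (b * a)"
  shows "a = 0"
proof (rule ccontr)
  assume "a \<noteq> 0"
  interpret finite_dimensional_vector_space scale "e ` {..<n}"
    using basis by (rule finite_dimensional_if_is_basis)
  interpret L: Vector_Spaces.linear scale scale "(*) a" by (rule linear_mult_left)
  interpret R: Vector_Spaces.linear scale scale "\<lambda>x. x * a" by (rule linear_mult_right)
  note F_simps = dual_add[OF F] dual_diff[OF F] dual_scale[OF F] dual_zero[OF F]
  have not_right_inverse: "a * b \<noteq> 1" for b
    using right_inverse_imp_left_inverse[OF basis, of a b] a[of b] F1 \<alpha>(2) by auto
  then have not_left_inverse: "b * a \<noteq> 1" for b
    using right_inverse_imp_left_inverse[OF basis, of b a] by auto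
  have left_zero: "s = 0" if s: "s = a * b" and zero: "\<And>x. F (s * x - x * s) = 0" for s b
  proof -
    obtain c where c: "s = scale c 1"
      using stab zero by (auto simp: lie_stabilizer_def)
    \<comment> \<open>A nonzero scalar in the right ideal generated by \<open>a\<close> would make
      \<open>a\<close> right invertible.\<close>
    have "a * scale (1 / c) b = 1" if "c \<noteq> 0"
      using c s that by (metis scale_mult_right scale_scale scale_one nonzero_eq_divide_eq)
    then show ?thesis
      using not_right_inverse c by (cases "c = 0") auto
  qed
  have right_zero: "s = 0" if s: "s = b * a" and zero: "\<And>x. F (s * x - x * s) = 0" for s b
  proof -
    obtain c where c: "s = scale c 1"
      using stab zero by (auto simp: lie_stabilizer_def)
    have "scale (1 / c) b * a = 1" if "c \<noteq> 0"
      using c s that by (metis scale_mult_left scale_scale scale_one nonzero_eq_divide_eq)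
    then show ?thesis
      using not_left_inverse c by (cases "c = 0") auto
  qed
  have lin: "Vector_Spaces.linear scale (*) (\<lambda>x. F (s * x - x * s))"
    "Vector_Spaces.linear scale (*) (\<lambda>x. F (x * s - s * x))" for s
    using dualI[of "\<lambda>x. F (s * x - x * s)"] dualI[of "\<lambda>x. F (x * s - s * x)"]
    by (simp_all add: dual_def F_simps distrib_left distrib_right scale_mult_left scale_mult_right
        algebra_simps)
  have rot: "F (a * b * x) = \<alpha> * F (b * (x * a))" for b x
    using a[of "b * x"] by (simp add: mult.assoc)
  have "dim (range ((*) a)) < dim (range (\<lambda>x. x * a))"
  proof (rule dim_less_dim_range_of_pairing[where u = 1 and \<beta> = "\<lambda>s x. F (s * x - x * s)"])
    show "F (s * x - x * s) = 0" if "s \<in> range ((*) a)" "x * a = 0" for s x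
    proof -
      obtain b where b: "s = a * b" using \<open>s \<in> range ((*) a)\<close> by auto
      have "x * s = 0" using b that by (simp add: mult.assoc[symmetric])
      then show ?thesis using rot[of b x] b that by (simp add: F_simps)
    qed
  qed (use lin left_zero \<open>a \<noteq> 0\<close> linear_mult_right L.subspace_image[OF subspace_UNIV]
      in \<open>auto simp: F_simps\<close>)
  moreover have "dim (range (\<lambda>x. x * a)) < dim (range ((*) a))"
  proof (rule dim_less_dim_range_of_pairing[where u = 1 and \<beta> = "\<lambda>s x. F (s * x - x * s)"])
    show "F (s * x - x * s) = 0" if "s \<in> range (\<lambda>x. x * a)" "a * x = 0" for s x
    proof -
      obtain b where b: "s = b * a" using \<open>s \<in> range (\<lambda>x. x * a)\<close> by auto
      have "s * x = 0" using b that by (simp add: mult.assoc)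
      \<comment> \<open>Here \<open>rot\<close> is read from right to left:
        \<open>\<alpha> * F (x * (b * a)) = F (a * x * b) = 0\<close>, and \<alpha> can be
        cancelled.\<close>
      moreover have "F (x * s) = 0"
        using rot[of x b] b that \<alpha>(1) by (simp add: F_simps)
      ultimately show ?thesis by (simp only: dual_diff[OF F] dual_zero[OF F] diff_zero)
    qed
  qed (use lin right_zero \<open>a \<noteq> 0\<close> linear_mult_left R.subspace_image[OF subspace_UNIV]
      in \<open>auto simp: F_simps\<close>)
  ultimately show False by simp
qed

section \<open>Degenerate forms and the polynomial defining the open set\<close>

text \<open>The coordinate map \<open>el\<close> is a bijection from vectors to the algebra, and
  \<open>M\<close> applied to \<open>v\<close> lists the values of \<open>\<gamma>\<close> at the
  pairs \<open>e i\<close>, \<open>el v\<close>. Kernel vectors of \<open>M\<close> are thus the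
  coordinates of elements of the right radical of \<open>\<gamma>\<close>.\<close>

lemma det_bilinear_eq_0_iff:
  assumes basis: "is_basis n e"
    and left: "\<And>a. (\<lambda>x. \<gamma> x a) \<in> dual" and right: "\<And>x. \<gamma> x \<in> dual"
  shows "det (mat n n (\<lambda>(i, j). \<gamma> (e i) (e j))) = 0 \<longleftrightarrow> (\<exists>a. a \<noteq> 0 \<and> (\<forall>x. \<gamma> x a = 0))"
proof -
  define M where "M = mat n n (\<lambda>(i, j). \<gamma> (e i) (e j))"
  define el where "el v = (\<Sum>j<n. scale (v $ j) (e j))" for v :: "complex vec"
  have inj: "inj_on e {..<n}" and indep: "independent (e ` {..<n})"
    and span: "span (e ` {..<n}) = UNIV"
    using basis by (auto simp: is_basis_def)
  have M: "M \<in> carrier_mat n n" by (simp add: M_def)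
  have \<gamma>_el: "\<gamma> x (el v) = (\<Sum>j<n. v $ j * \<gamma> x (e j))" for x v
  proof -
    interpret r: Vector_Spaces.linear scale "(*)" "\<gamma> x" using right by (simp add: dual_def)
    show ?thesis by (simp add: el_def r.sum r.scale)
  qed
  have mult: "M *\<^sub>v v = vec n (\<lambda>i. \<gamma> (e i) (el v))" if "v \<in> carrier_vec n" for v
    using that
    by (auto simp: M_def \<gamma>_el scalar_prod_def mult.commute lessThan_atLeast0 intro!: eq_vecI sum.cong)
  have all: "(\<forall>i<n. \<gamma> (e i) a = 0) \<longleftrightarrow> (\<forall>x. \<gamma> x a = 0)" for a
  proof
    interpret l: Vector_Spaces.linear scale "(*)" "\<lambda>x. \<gamma> x a" using left by (simp add: dual_def)
    assume "\<forall>i<n. \<gamma> (e i) a = 0"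
    then have "span (e ` {..<n}) \<subseteq> {x. \<gamma> x a = 0}"
      by (intro span_minimal l.subspace_kernel) auto
    then show "\<forall>x. \<gamma> x a = 0" by (auto simp: span)
  qed simp
  have zero: "v = 0\<^sub>v n" if v: "v \<in> carrier_vec n" and "el v = 0" for v
  proof -
    \<comment> \<open>Independence concerns coefficients indexed by basis elements;
      \<open>the_inv_into\<close> converts the positions \<open>j\<close> into such indices.\<close>
    have "(\<Sum>y\<in>e ` {..<n}. scale (v $ the_inv_into {..<n} e y) y) = 0"
      using that inj by (simp add: sum.reindex the_inv_into_f_f el_def)
    then have "v $ the_inv_into {..<n} e y = 0" if "y \<in> e ` {..<n}" for y
      using independentD[OF indep _ subset_refl _ that, of "\<lambda>y. v $ the_inv_into {..<n} e y"]
      by simp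
    then have "v $ i = 0" if "i < n" for i
      using that inj by (metis imageI lessThan_iff the_inv_into_f_f)
    then show ?thesis
      using v by (auto intro!: eq_vecI)
  qed
  have surj: "\<exists>v\<in>carrier_vec n. a = el v" for a
  proof -
    have "a \<in> span (e ` {..<n})" by (simp add: span)
    then obtain c where "a = (\<Sum>y\<in>e ` {..<n}. scale (c y) y)"
      by (auto simp: span_finite)
    then have "a = el (vec n (\<lambda>j. c (e j)))"
      using inj by (simp add: sum.reindex el_def)
    then show ?thesis by (metis vec_carrier)
  qed
  have "det M = 0 \<longleftrightarrow> (\<exists>v\<in>carrier_vec n. v \<noteq> 0\<^sub>v n \<and> (\<forall>i<n. \<gamma> (e i) (el v) = 0))"
  proof -
    have "M *\<^sub>v v = 0\<^sub>v n \<longleftrightarrow> (\<forall>i<n. \<gamma> (e i) (el v) = 0)" if "v \<in> carrier_vec n" for v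
      using mult[OF that] by (auto simp: vec_eq_iff)
    then show ?thesis
      unfolding det_0_iff_vec_prod_zero_field[OF M] by blast
  qed
  also have "\<dots> \<longleftrightarrow> (\<exists>v\<in>carrier_vec n. v \<noteq> 0\<^sub>v n \<and> (\<forall>x. \<gamma> x (el v) = 0))"
    by (simp add: all)
  also have "\<dots> \<longleftrightarrow> (\<exists>a. a \<noteq> 0 \<and> (\<forall>x. \<gamma> x a = 0))"
  proof -
    have "el (0\<^sub>v n) = 0" by (simp add: el_def)
    then show ?thesis using zero surj by metis
  qed
  finally show ?thesis by (simp add: M_def)
qed

text \<open>The rank-one term removes the kernel vector \<open>1\<close> of the commutator form.  The case \<open>\<psi> = F\<close> gives
  the polynomial that cuts out the open set; a fixed \<open>\<psi>\<close> is needed to find a point where it does not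
  vanish, since a functional with minimal stabilizer may vanish at \<open>1\<close>.\<close>

definition bordered_det :: "nat \<Rightarrow> (nat \<Rightarrow> 'a) \<Rightarrow> ('a \<Rightarrow> complex) \<Rightarrow> ('a \<Rightarrow> complex) \<Rightarrow> complex" where
  "bordered_det n e \<psi> F =
     det (mat n n (\<lambda>(i, j). F (e i * e j - e j * e i) + \<psi> (e i) * \<psi> (e j)))"

text \<open>Pairing a radical element \<open>a\<close> with \<open>1\<close> kills the commutator
  and leaves \<open>\<psi> 1 * \<psi> a = 0\<close>. If \<open>\<psi> 1\<close> is nonzero, the
  radical is therefore the part of the stabilizer on which \<open>\<psi>\<close> vanishes, which is
  zero exactly when the stabilizer consists of scalars. If \<open>\<psi> 1 = 0\<close>, then
  \<open>1\<close> itself is in the radical.\<close>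

lemma bordered_det_nonzero_iff:
  assumes basis: "is_basis n e" and F: "F \<in> dual" and \<psi>: "\<psi> \<in> dual"
  shows "bordered_det n e \<psi> F \<noteq> 0 \<longleftrightarrow>
    \<psi> 1 \<noteq> 0 \<and> lie_stabilizer F \<subseteq> range (\<lambda>c. scale c 1)"
proof -
  note F_simps = dual_add[OF F] dual_diff[OF F] dual_scale[OF F] dual_zero[OF F]
    dual_add[OF \<psi>] dual_diff[OF \<psi>] dual_scale[OF \<psi>] dual_zero[OF \<psi>]
  define \<gamma> where "\<gamma> x a = F (x * a - a * x) + \<psi> x * \<psi> a" for x a
  have "(\<lambda>x. \<gamma> x a) \<in> dual" "\<gamma> a \<in> dual" for a
    by (rule dualI; simp add: \<gamma>_def F_simps distrib_left distrib_right scale_mult_left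
        scale_mult_right algebra_simps)+
  then have "bordered_det n e \<psi> F = 0 \<longleftrightarrow> (\<exists>a. a \<noteq> 0 \<and> (\<forall>x. \<gamma> x a = 0))"
    using det_bilinear_eq_0_iff[OF basis, of \<gamma>] by (simp add: bordered_det_def \<gamma>_def)
  also have "\<dots> \<longleftrightarrow> \<psi> 1 = 0 \<or> \<not> lie_stabilizer F \<subseteq> range (\<lambda>c. scale c 1)"
  proof
    assume "\<exists>a. a \<noteq> 0 \<and> (\<forall>x. \<gamma> x a = 0)"
    then obtain a where a: "a \<noteq> 0" "\<And>x. \<gamma> x a = 0" by blast
    show "\<psi> 1 = 0 \<or> \<not> lie_stabilizer F \<subseteq> range (\<lambda>c. scale c 1)"
    proof (rule ccontr)
      assume "\<not> ?thesis"
      then have \<psi>1: "\<psi> 1 \<noteq> 0" and stab: "lie_stabilizer F \<subseteq> range (\<lambda>c. scale c 1)" by auto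
      have \<psi>a: "\<psi> a = 0"
        using a(2)[of 1] \<psi>1 by (simp add: \<gamma>_def F_simps)
      have "F (a * x - x * a) = 0" for x
        using a(2)[of x] \<psi>a by (simp add: \<gamma>_def F_simps)
      then obtain c where "a = scale c 1"
        using stab by (auto simp: lie_stabilizer_def)
      then show False
        using \<psi>a \<psi>1 a(1) by (simp add: F_simps)
    qed
  next
    assume *: "\<psi> 1 = 0 \<or> \<not> lie_stabilizer F \<subseteq> range (\<lambda>c. scale c 1)"
    show "\<exists>a. a \<noteq> 0 \<and> (\<forall>x. \<gamma> x a = 0)"
    proof (cases "\<psi> 1 = 0")
      case True
      then show ?thesis by (intro exI[of _ 1]) (simp add: \<gamma>_def F_simps)
    next
      case False
      then obtain a where a: "a \<in> lie_stabilizer F" "a \<notin> range (\<lambda>c. scale c 1)"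
        using * by auto
      \<comment> \<open>Subtracting a scalar moves \<open>a\<close> into the kernel of
        \<open>\<psi>\<close>; the result still stabilizes \<open>F\<close> because scalars are
        central, and it is nonzero because \<open>a\<close> is not a scalar.\<close>
      define a' where "a' = a - scale (\<psi> a / \<psi> 1) 1"
      have "F (x * a' - a' * x) = 0" for x
        using a(1) by (simp add: a'_def lie_stabilizer_def F_simps left_diff_distrib
            right_diff_distrib scale_mult_left scale_mult_right)
      moreover have "\<psi> a' = 0"
        using False by (simp add: a'_def F_simps)
      moreover have "a' \<noteq> 0"
        using a(2) by (auto simp: a'_def)
      ultimately show ?thesis
        by (intro exI[of _ a']) (simp add: \<gamma>_def)
    qed
  qed
  finally show ?thesis by blast
qed

text \<open>An infimum of natural numbers is attained, so some stabilizer has dimension 1; as it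
  contains \<open>1\<close>, it lies in the line spanned by \<open>1\<close>.\<close>

lemma ex_lie_stabilizer_eq_scalars:
  assumes "is_basis n e" and "lie_index = 1"
  shows "\<exists>F\<in>dual. lie_stabilizer F \<subseteq> range (\<lambda>c. scale c 1)"
proof -
  interpret finite_dimensional_vector_space scale "e ` {..<n}"
    using assms(1) by (rule finite_dimensional_if_is_basis)
  have "(\<lambda>_. 0) \<in> dual" by (rule dualI) simp_all
  then have "lie_index \<in> (\<lambda>F. dim (lie_stabilizer F)) ` dual"
    unfolding lie_index_def by (intro Inf_nat_def1) auto
  then obtain F where F: "F \<in> dual" and dim1: "dim (lie_stabilizer F) = 1"
    using assms(2) by auto
  have "span {1} \<subseteq> span (lie_stabilizer F)"
    by (intro span_mono) (auto simp: lie_stabilizer_def dual_zero[OF F])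
  moreover have "dim (span {1 :: 'a}) = dim (span (lie_stabilizer F))"
    using dim1 by simp
  ultimately have "span {1} = span (lie_stabilizer F)"
    by (intro subspace_dim_equal) auto
  then have "lie_stabilizer F \<subseteq> span {1}"
    using span_superset by blast
  then show ?thesis
    using F by (auto simp: span_singleton)
qed

text \<open>A functional with scalar stabilizer is perturbed along \<open>\<psi>\<close>: continuity
  keeps the determinant with fixed border \<open>\<psi>\<close> nonzero for small \<open>t\<close>,
  while the value at \<open>1\<close> becomes nonzero.\<close>

lemma ex_bordered_det_nonzero:
  assumes basis: "is_basis n e" and "lie_index = 1"
  shows "\<exists>F\<in>dual. bordered_det n e F F \<noteq> 0"
proof -
  obtain F where F: "F \<in> dual" and stab: "lie_stabilizer F \<subseteq> range (\<lambda>c. scale c 1)"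
    using ex_lie_stabilizer_eq_scalars[OF assms] by blast
  obtain \<psi> where \<psi>: "\<psi> \<in> dual" "\<psi> 1 = 1"
    using ex_dual_one by blast
  define G where "G t x = F x + t * \<psi> x" for t x
  have G: "G t \<in> dual" for t
    by (rule dualI)
      (simp_all add: G_def dual_add[OF F] dual_scale[OF F] dual_add[OF \<psi>(1)]
        dual_scale[OF \<psi>(1)] algebra_simps)
  have G0: "G 0 = F" by (simp add: G_def fun_eq_iff)
  have "isCont (\<lambda>t. bordered_det n e \<psi> (G t)) 0"
    unfolding bordered_det_def G_def by (intro continuous_det continuous_intros)
  moreover have "bordered_det n e \<psi> (G 0) \<noteq> 0"
    using bordered_det_nonzero_iff[OF basis F \<psi>(1)] \<psi>(2) stab G0 by simp
  ultimately have "\<forall>\<^sub>F t in at 0. bordered_det n e \<psi> (G t) \<noteq> 0"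
    unfolding isCont_def by (rule tendsto_imp_eventually_ne)
  \<comment> \<open>Since \<open>\<psi> 1 = 1\<close>, the value \<open>G t 1\<close> is
    \<open>F 1 + t\<close>, which vanishes only at this \<open>t\<close>.\<close>
  moreover have "\<forall>\<^sub>F t in at 0. t \<noteq> - F 1"
    using eventually_neq_at_within[of "- F 1" 0 UNIV] by simp
  ultimately have "\<forall>\<^sub>F t in at 0. bordered_det n e \<psi> (G t) \<noteq> 0 \<and> t \<noteq> - F 1"
    by (rule eventually_conj)
  then obtain t where "bordered_det n e \<psi> (G t) \<noteq> 0" "t \<noteq> - F 1"
    using eventually_happens[of _ "at (0::complex)"] by auto
  then have "lie_stabilizer (G t) \<subseteq> range (\<lambda>c. scale c 1)" and "G t 1 \<noteq> 0"
    using bordered_det_nonzero_iff[OF basis G \<psi>(1)] \<psi>(2) by (auto simp: G_def add_eq_0_iff)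
  then show ?thesis
    using bordered_det_nonzero_iff[OF basis G G] G by blast
qed

section \<open>Vanishing of the spaces \<open>V\<close> and existence of \<mu>\<close>

lemma V_eq_0:
  assumes basis: "is_basis n e" and F: "F \<in> dual" and "F 1 \<noteq> 0"
    and "lie_stabilizer F \<subseteq> range (\<lambda>c. scale c 1)" and \<alpha>: "\<alpha> \<noteq> 0" "\<alpha> \<noteq> 1"
  shows "V F \<mu> k \<alpha> = {0}"
proof -
  have twisted: "(\<forall>b. F (a * b) = \<alpha> * F (b * a)) \<longleftrightarrow> a = 0" for a
    using twisted_stabilizer_trivial[OF assms] dual_zero[OF F] by auto
  show ?thesis
    by (induction k) (auto simp: twisted dual_zero[OF F])
qed

lemma invertible_form_mat_minus_double_transpose:
  assumes basis: "is_basis n e" and F: "F \<in> dual" and "F 1 \<noteq> 0"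
    and "lie_stabilizer F \<subseteq> range (\<lambda>c. scale c 1)"
  shows "invertible_mat (form_mat n e F - 2 \<cdot>\<^sub>m transpose_mat (form_mat n e F))"
proof -
  define \<gamma> where "\<gamma> x a = F (x * a) - 2 * F (a * x)" for x a
  have "(\<lambda>x. \<gamma> x a) \<in> dual" "\<gamma> a \<in> dual" for a
    by (rule dualI; simp add: \<gamma>_def dual_add[OF F] dual_scale[OF F] distrib_left distrib_right
        scale_mult_left scale_mult_right algebra_simps)+
  moreover have "a = 0" if "\<forall>x. \<gamma> x a = 0" for a
    \<comment> \<open>A radical element satisfies \<open>F (x * a) = 2 * F (a * x)\<close>, which is
      the twisted condition with factor \<open>1 / 2\<close>.\<close>
    by (rule twisted_stabilizer_trivial[OF assms, of "1 / 2"]) (use that in \<open>auto simp: \<gamma>_def\<close>)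
  ultimately have "det (mat n n (\<lambda>(i, j). \<gamma> (e i) (e j))) \<noteq> 0"
    using det_bilinear_eq_0_iff[OF basis, of \<gamma>] by blast
  moreover have "mat n n (\<lambda>(i, j). \<gamma> (e i) (e j)) =
      form_mat n e F - 2 \<cdot>\<^sub>m transpose_mat (form_mat n e F)"
    by (rule eq_matI) (auto simp: form_mat_def \<gamma>_def)
  ultimately show ?thesis
    by (intro invertible_mat_if_det_nonzero[where n = n]) (auto simp: form_mat_def)
qed

end

theorem theorem21:
  fixes scale :: "complex \<Rightarrow> 'a::ring_1 \<Rightarrow> 'a"
    and n :: nat and e :: "nat \<Rightarrow> 'a"
  assumes "fin_dim_algebra scale"
    and "fin_dim_algebra.is_basis scale n e"
    and "fin_dim_algebra.lie_index scale = 1"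
  shows "fin_dim_algebra.generically scale (\<lambda>F.
    (\<exists>\<mu>. invertible_mat (form_mat n e F - \<mu> \<cdot>\<^sub>m transpose_mat (form_mat n e F))) \<and>
    (\<forall>\<mu>. invertible_mat (form_mat n e F - \<mu> \<cdot>\<^sub>m transpose_mat (form_mat n e F)) \<longrightarrow>
      (\<forall>k \<alpha>. \<alpha> \<noteq> 0 \<and> \<alpha> \<noteq> 1 \<longrightarrow> vector_space.dim scale (V F \<mu> k \<alpha>) = 0)))"
proof -
  interpret fin_dim_algebra scale by fact
  interpret finite_dimensional_vector_space scale "e ` {..<n}"
    using assms(2) by (rule finite_dimensional_if_is_basis)
  define p where "p = (\<lambda>F. bordered_det n e F F)"
  define U where "U = dual - {F \<in> dual. \<forall>q\<in>{p}. q F = 0}"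
  have "poly_fun p"
    unfolding p_def bordered_det_def by (intro poly_fun_det poly_fun.intros)
  then have "zariski_open U"
    unfolding zariski_open_def U_def by (intro exI[of _ "{p}"]) auto
  moreover have "U \<noteq> {}"
    using ex_bordered_det_nonzero[OF assms(2,3)] by (auto simp: U_def p_def)
  moreover have "(\<exists>\<mu>. invertible_mat (form_mat n e F - \<mu> \<cdot>\<^sub>m transpose_mat (form_mat n e F))) \<and>
      (\<forall>\<mu> k \<alpha>. \<alpha> \<noteq> 0 \<and> \<alpha> \<noteq> 1 \<longrightarrow> dim (V F \<mu> k \<alpha>) = 0)" if "F \<in> U" for F
  proof -
    have "F \<in> dual" "F 1 \<noteq> 0" "lie_stabilizer F \<subseteq> range (\<lambda>c. scale c 1)"
      using that bordered_det_nonzero_iff[OF assms(2), of F F] by (auto simp: U_def p_def)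
    then show ?thesis
      using invertible_form_mat_minus_double_transpose[OF assms(2)] V_eq_0[OF assms(2)] by auto
  qed
  ultimately show ?thesis
    unfolding generically_def by blast
qed

end
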